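(* Let $k \geq 2$ be a positive integer and let $f\colon [1,\infty) \to \mathbb{R}$ be a $k$-times continuously differentiable function such that $$\lim_{x \to \infty} f^{(k)}(x) = 0 \qquad\text{and}\qquad \limsup_{x \to \infty} f^{(k-1)}(x) = \infty.$$ Then there exists an infinite subset $\mathcal{A} \subset \mathbb{N}$ having upper Banach density equal to $1$ such that $$\gcd\left(\lfloor f(n_1)\rfloor, \lfloor f(n_2)\rfloor, \ldots, \lfloor f(n_k)\rfloor\right) = 1$$ for any set $\{n_1, n_2, \ldots, n_k\}$ of $k$ distinct integers in $\mathcal{A}$.
   Context: $\mathbb{N}$ is the set of positive integers. $\lfloor x \rfloor$ denotes the greatest integer less than or equal to the real number $x$. $f^{(i)}$ denotes the $i$-th derivative of $f$, with $f^{(0)} = f$. The upper Banach density of a subset $\mathcal{S}$ of $\mathbb{N}$ is defined by $$\lim_{H \to \infty} \limsup_{x \to \infty} \frac{1}{H}\,\#\left(\mathcal{S} \cap (x, x+H]\right).$$ *)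

theory Defs
  imports "HOL-Analysis.Analysis"
begin

(* Iterated derivatives are taken relative to S, hence one-sided at a boundary point
   of an interval S.  The values are only meaningful at points of S, provided S has no
   isolated points and the derivatives exist. *)

primrec deriv_within :: "real set \<Rightarrow> nat \<Rightarrow> (real \<Rightarrow> real) \<Rightarrow> real \<Rightarrow> real" where
  "deriv_within S 0 f = f"
| "deriv_within S (Suc i) f = (\<lambda>x. vector_derivative (deriv_within S i f) (at x within S))"

definition C_on :: "nat \<Rightarrow> real set \<Rightarrow> (real \<Rightarrow> real) \<Rightarrow> bool" where
  "C_on k S f \<longleftrightarrow>
     (\<forall>i<k. deriv_within S i f differentiable_on S) \<and> continuous_on S (deriv_within S k f)"

(* Existence of the limit over H is part of the definition.  Both H and x are real. *)

definition has_upper_Banach_density :: "nat set \<Rightarrow> ereal \<Rightarrow> bool" where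
  "has_upper_Banach_density S d \<longleftrightarrow>
     ((\<lambda>H::real. Limsup at_top
         (\<lambda>x::real. ereal (1 / H * real (card {n \<in> S. real n \<in> {x<..x + H}})))) \<longlongrightarrow> d) at_top"

end

(* Idea: as f^(k) tends to 0 and f^(k-1) is unbounded above, f^(k-1) passes very slowly through the
   value (k-1)! M^j.  Subtract 1 + M^j x^(k-1).  The (k-1)-th derivative of the remainder climbs
   slowly from 0 to a small eta, so the (k-2)-th one, which moves slowly as well, drifts far enough
   to pass through a multiple of (k-2)! M; subtract the corresponding integer monomial, and
   continue down to the function itself.  The result is a long interval on which floor(f(n)) = Q(n)
   for an integer polynomial Q of degree k-1 with Q = 1 mod M and leading coefficient M^j.  Values
   of Q are coprime to M.  If H! divides M, a prime dividing the values at k distinct points of a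
   window of length H divides the leading coefficient M^j (k roots modulo p), which is absurd.
   Windows of growing length are chosen successively, with M divisible by all values on the earlier
   windows, so that values from different windows are coprime. *)

theory Submission
  imports Defs "HOL-Computational_Algebra.Polynomial" "HOL-Computational_Algebra.Primes"
begin

section \<open>Level crossings and Lipschitz bounds on the real line\<close>

lemma compact_closed_subset_Icc: "closed S \<Longrightarrow> S \<subseteq> {p..q} \<Longrightarrow> compact S" for S :: "real set"
  using compact_Int_closed[OF compact_Icc, of S p q] by (simp add: Int_absorb1)

text \<open>Take \<open>b\<close> as the first point where \<open>u\<close> equals \<open>d\<close>,
  then \<open>a\<close> as the last point before \<open>b\<close> where \<open>u\<close> equals
  \<open>c\<close>. By the intermediate value theorem, leaving \<open>{c..d}\<close> in between
  would produce an earlier \<open>d\<close> or a later \<open>c\<close>.\<close>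

lemma exists_crossing_interval:
  fixes u :: "real \<Rightarrow> real"
  assumes cont: "continuous_on {p..q} u" and "p \<le> q" "u p \<le> c" "d \<le> u q" "c < d"
  obtains a b where "p \<le> a" "a < b" "b \<le> q" "u a = c" "u b = d" "\<And>x. x \<in> {a..b} \<Longrightarrow> u x \<in> {c..d}"
proof -
  define B where "B = {x \<in> {p..q}. u x = d}"
  have "\<exists>x\<ge>p. x \<le> q \<and> u x = d"
    using assms by (intro IVT') auto
  then have "B \<noteq> {}" by (auto simp: B_def)
  moreover have "closed B"
    unfolding B_def by (intro continuous_closed_preimage_constant cont closed_atLeastAtMost)
  then have "compact B"
    by (rule compact_closed_subset_Icc) (auto simp: B_def)
  ultimately obtain b where b: "b \<in> B" "\<And>x. x \<in> B \<Longrightarrow> b \<le> x"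
    using compact_attains_inf[of B] by metis
  have ub: "u x \<le> d" if "x \<in> {p..b}" for x
  proof (rule ccontr)
    assume "\<not> u x \<le> d"
    then have "\<exists>y\<ge>p. y \<le> x \<and> u y = d"
      using assms that b(1) by (intro IVT') (auto simp: B_def intro: continuous_on_subset)
    then obtain y where y: "p \<le> y" "y \<le> x" "u y = d" by blast
    then have "b \<le> y" using that b by (auto simp: B_def)
    then have "x = b" using y that by auto
    then show False using b(1) \<open>\<not> u x \<le> d\<close> by (auto simp: B_def)
  qed
  define A where "A = {x \<in> {p..b}. u x = c}"
  have contb: "continuous_on {p..b} u"
    using b(1) by (intro continuous_on_subset[OF cont]) (auto simp: B_def)
  have "\<exists>x\<ge>p. x \<le> b \<and> u x = c"
    using assms b(1) contb by (intro IVT') (auto simp: B_def)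
  then have "A \<noteq> {}" by (auto simp: A_def)
  moreover have "closed A"
    unfolding A_def by (intro continuous_closed_preimage_constant contb closed_atLeastAtMost)
  then have "compact A"
    by (rule compact_closed_subset_Icc) (auto simp: A_def)
  ultimately obtain a where a: "a \<in> A" "\<And>x. x \<in> A \<Longrightarrow> x \<le> a"
    using compact_attains_sup[of A] by metis
  have lb: "u x \<ge> c" if "x \<in> {a..b}" for x
  proof (rule ccontr)
    assume "\<not> u x \<ge> c"
    then have "\<exists>y\<ge>x. y \<le> b \<and> u y = c"
      using assms that a(1) b(1) contb 
      by (intro IVT') (auto simp: A_def B_def intro: continuous_on_subset)
    then obtain y where y: "x \<le> y" "y \<le> b" "u y = c" by blast
    then have "y \<le> a" using that a by (auto simp: A_def)
    then have "x = a" using y that by auto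
    then show False using a(1) \<open>\<not> u x \<ge> c\<close> by (auto simp: A_def)
  qed
  have "a \<noteq> b" using a(1) b(1) \<open>c < d\<close> by (auto simp: A_def B_def)
  show thesis
    by (rule that[of a b]) (use a(1) b(1) \<open>a \<noteq> b\<close> ub lb in \<open>auto simp: A_def B_def\<close>)
qed

lemma abs_diff_le_if_bounded_deriv:
  fixes u u' :: "real \<Rightarrow> real"
  assumes "\<And>x. x \<in> {p..q} \<Longrightarrow> (u has_real_derivative u' x) (at x within {p..q})"
    and "\<And>x. x \<in> {p..q} \<Longrightarrow> \<bar>u' x\<bar> \<le> \<theta>" "x \<in> {p..q}" "y \<in> {p..q}"
  shows "\<bar>u x - u y\<bar> \<le> \<theta> * \<bar>x - y\<bar>"
  using field_differentiable_bound[of "{p..q}" u u' \<theta> x y] assms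
  by auto

section \<open>Approximation by integer polynomials with coefficients divisible by M\<close>

text \<open>The \<open>i\<close>-th derivative of \<open>c * x ^ r / fact r\<close>.\<close>

definition monomial_tower :: "real \<Rightarrow> nat \<Rightarrow> nat \<Rightarrow> real \<Rightarrow> real" where
  "monomial_tower c r i x = (if i \<le> r then c * (x ^ (r - i) / fact (r - i)) else 0)"

lemma monomial_tower_simps [simp]:
  "monomial_tower c r r x = c" "r < i \<Longrightarrow> monomial_tower c r i x = 0"
  by (auto simp: monomial_tower_def)

lemma has_derivative_monomial_tower:
  "(monomial_tower c r i has_real_derivative monomial_tower c r (Suc i) x) (at x within S)"
proof (cases "i < r")
  case True
  then obtain n where n: "r - i = Suc n" "r - Suc i = n"
    by (metis Suc_diff_Suc)
  have "((\<lambda>x. x ^ Suc n / fact (Suc n)) has_real_derivative real (Suc n) * x ^ n / fact (Suc n))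
      (at x within S)"
    using DERIV_cdivide[OF DERIV_pow[of "Suc n" x S], of "fact (Suc n)"] by simp
  also have "real (Suc n) * x ^ n / fact (Suc n) = x ^ n / fact n"
    by (simp add: divide_simps)
  finally have "((\<lambda>x. x ^ Suc n / fact (Suc n)) has_real_derivative x ^ n / fact n) (at x within S)" .
  from DERIV_cmult[OF this, of c] show ?thesis
    using True n by (simp add: monomial_tower_def[abs_def] del: power_Suc fact_Suc)
next
  case False
  then have "monomial_tower c r i = (\<lambda>_. if i = r then c else 0)"
    by (auto simp: fun_eq_iff monomial_tower_def)
  with False show ?thesis by simp
qed

text \<open>
  \<open>G i\<close> plays the role of the \<open>i\<close>-th derivative of \<open>G 0\<close>. A slow climb of the \<open>r\<close>-th derivative
  from \<open>0\<close> to \<open>\<eta>\<close> forces \<open>G 0\<close> to stay just above an integer polynomial of degree less than \<open>r\<close>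
  with coefficients divisible by \<open>M\<close>, on some subinterval of length \<open>L\<close>.
\<close>

definition forces_poly_approx :: "int \<Rightarrow> real \<Rightarrow> nat \<Rightarrow> real \<Rightarrow> real \<Rightarrow> bool" where
  "forces_poly_approx M L r \<eta> \<theta> \<longleftrightarrow> (\<forall>(G :: nat \<Rightarrow> real \<Rightarrow> real) p q. p < q \<longrightarrow>
      (\<forall>i\<le>r. \<forall>x\<in>{p..q}. (G i has_real_derivative G (Suc i) x) (at x within {p..q})) \<longrightarrow>
      G r p = 0 \<longrightarrow> G r q = \<eta> \<longrightarrow> (\<forall>x\<in>{p..q}. G r x \<in> {0..\<eta>} \<and> \<bar>G (Suc r) x\<bar> \<le> \<theta>) \<longrightarrow>
      (\<exists>a b (c :: nat \<Rightarrow> int). p \<le> a \<and> a + L \<le> b \<and> b \<le> q \<and>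
        (\<forall>x\<in>{a..b}. G 0 x - of_int M * (\<Sum>i<r. of_int (c i) * x ^ i) \<in> {0..1/2})))"

text \<open>Induction on \<open>r\<close>, one monomial per level. The thresholds are fixed before
  \<open>G\<close>, so the inductive step can choose its derivative bound small enough for level
  \<open>r\<close> to drift past a suitable multiple of \<open>M * fact r\<close>.\<close>

lemma forces_poly_approx_exists:
  assumes "M > 0" "L > 0"
  shows "\<exists>\<eta> \<theta>. \<eta> > 0 \<and> \<theta> > 0 \<and> forces_poly_approx M L r \<eta> \<theta>"
proof (induction r)
  case 0
  show ?case
  proof (rule exI[of _ "1/2"], rule exI[of _ "1 / (2 * L)"], unfold forces_poly_approx_def, intro conjI allI impI)
    fix G :: "nat \<Rightarrow> real \<Rightarrow> real" and p q :: real
    assume *: "p < q" "\<forall>i\<le>0. \<forall>x\<in>{p..q}. (G i has_real_derivative G (Suc i) x) (at x within {p..q})"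
      "G 0 p = 0" "G 0 q = 1/2" "\<forall>x\<in>{p..q}. G 0 x \<in> {0..1/2} \<and> \<bar>G (Suc 0) x\<bar> \<le> 1 / (2 * L)"
    \<comment> \<open>A climb of 1/2 at slope at most \<open>1 / (2 * L)\<close> takes length at
      least \<open>L\<close>.\<close>
    have "\<bar>G 0 q - G 0 p\<bar> \<le> 1 / (2 * L) * \<bar>q - p\<bar>"
      using * by (intro abs_diff_le_if_bounded_deriv[of p q "G 0" "G (Suc 0)"]) auto
    then have "p + L \<le> q" using * \<open>L > 0\<close> by (simp add: field_simps)
    then show "\<exists>a b (c :: nat \<Rightarrow> int). p \<le> a \<and> a + L \<le> b \<and> b \<le> q \<and>
        (\<forall>x\<in>{a..b}. G 0 x - of_int M * (\<Sum>i<0. of_int (c i) * x ^ i) \<in> {0..1/2})"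
      using * by (intro exI[of _ p] exI[of _ q]) auto
  qed (use \<open>L > 0\<close> in auto)
next
  case (Suc r)
  then obtain \<eta> \<theta> where "\<eta> > 0" "\<theta> > 0" and IH: "forces_poly_approx M L r \<eta> \<theta>"
    by blast
  \<comment> \<open>\<open>K\<close> is the \<open>r\<close>-th derivative of
    \<open>M * x ^ r\<close>, so multiples of \<open>K\<close> at level \<open>r\<close> come from
    integer multiples of that monomial.\<close>
  define K :: real where "K = of_int M * fact r"
  have "K > 0" using \<open>M > 0\<close> by (simp add: K_def)
  \<comment> \<open>Chosen so that speed \<open>\<theta> / 2\<close> kept up over length
    \<open>\<theta> / (2 * \<theta>')\<close> gains exactly \<open>K + \<eta>\<close>.\<close>
  define \<theta>' where "\<theta>' = \<theta>\<^sup>2 / (4 * (K + \<eta>))"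
  have "\<theta>' > 0" using \<open>K > 0\<close> \<open>\<eta> > 0\<close> \<open>\<theta> > 0\<close> by (simp add: \<theta>'_def)
  show ?case
  \<comment> \<open>The old derivative bound \<open>\<theta>\<close> becomes the new height: values
    of \<open>G (Suc r)\<close> in \<open>{0..\<theta>}\<close> are the slope bound that the
    induction hypothesis needs for \<open>G r\<close>.\<close>
  proof (rule exI[of _ \<theta>], rule exI[of _ \<theta>'], unfold forces_poly_approx_def, intro conjI allI impI)
    fix G :: "nat \<Rightarrow> real \<Rightarrow> real" and p q :: real
    assume "p < q" and der: "\<forall>i\<le>Suc r. \<forall>x\<in>{p..q}. (G i has_real_derivative G (Suc i) x) (at x within {p..q})"
      and G: "G (Suc r) p = 0" "G (Suc r) q = \<theta>"
        "\<forall>x\<in>{p..q}. G (Suc r) x \<in> {0..\<theta>} \<and> \<bar>G (Suc (Suc r)) x\<bar> \<le> \<theta>'"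
    have lip: "\<bar>G (Suc r) q - G (Suc r) x\<bar> \<le> \<theta>' * \<bar>q - x\<bar>" if "x \<in> {p..q}" for x
      using G der that by (intro abs_diff_le_if_bounded_deriv[of p q _ "G (Suc (Suc r))"]) auto
    \<comment> \<open>On the last stretch \<open>{s..q}\<close>, \<open>G (Suc r)\<close> is at least \<open>\<theta> / 2\<close>, so \<open>G r\<close> gains \<open>K + \<eta>\<close>.\<close>
    define s where "s = q - \<theta> / (2 * \<theta>')"
    \<comment> \<open>Reaching \<open>\<theta>\<close> from 0 at rate at most
      \<open>\<theta>'\<close> takes length at least \<open>\<theta> / \<theta>'\<close>, twice that
      of the last stretch.\<close>
    have "\<theta> \<le> \<theta>' * (q - p)" using lip[of p] G \<open>p < q\<close> \<open>\<theta> > 0\<close> by simp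
    then have "\<theta> / \<theta>' \<le> q - p" using \<open>\<theta>' > 0\<close> by (simp add: field_simps)
    moreover have "\<theta> / (2 * \<theta>') \<le> \<theta> / \<theta>'" "\<theta> / (2 * \<theta>') > 0"
      using \<open>\<theta>' > 0\<close> \<open>\<theta> > 0\<close> by (auto simp: field_simps)
    ultimately have s: "p \<le> s" "s < q" unfolding s_def by linarith+
    have half: "G (Suc r) x \<ge> \<theta> / 2" if "x \<in> {s..q}" for x
    proof -
      have "\<theta>' * (q - x) \<le> \<theta>' * (q - s)" 
        using that \<open>\<theta>' > 0\<close> by (intro mult_left_mono) auto
      also have "\<dots> = \<theta> / 2" using \<open>\<theta>' > 0\<close> by (simp add: s_def)
      finally show ?thesis using lip[of x] that s G(2) by auto
    qed
    have derr: "(G r has_real_derivative G (Suc r) x) (at x within {s..q})" if "x \<in> {s..q}" for x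
      by (rule DERIV_subset[OF der[rule_format, of r x]]) (use that s in auto)
    obtain \<xi> where \<xi>: "\<xi> \<in> {s..q}" "G r q - G r s = G (Suc r) \<xi> * (q - s)"
      using mvt_very_simple[of s q "G r" "\<lambda>x. (*) (G (Suc r) x)", OF less_imp_le[OF s(2)]]
        derr[unfolded has_field_derivative_def] by auto
    have "K + \<eta> = \<theta> / 2 * (q - s)"
      using \<open>\<theta> > 0\<close> \<open>K > 0\<close> \<open>\<eta> > 0\<close> by (simp add: s_def \<theta>'_def power2_eq_square)
    also have "\<dots> \<le> G r q - G r s"
      unfolding \<xi>(2) using half[of \<xi>] \<xi>(1) s by (intro mult_right_mono) auto
    finally have drift: "G r s + K + \<eta> \<le> G r q" by simp
    \<comment> \<open>The first multiple of \<open>K\<close> not below \<open>G r s\<close>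
      overshoots by at most \<open>K\<close>; the gain \<open>K + \<eta>\<close> leaves room for a
      full climb from \<open>l * K\<close> to \<open>l * K + \<eta>\<close>.\<close>
    define l where "l = \<lceil>G r s / K\<rceil>"
    have "G r s / K \<le> l" "l \<le> G r s / K + 1" unfolding l_def by linarith+
    then have l: "G r s \<le> l * K" "l * K \<le> G r s + K"
      using \<open>K > 0\<close> by (auto simp: field_simps)
    have "continuous_on {s..q} (G r)"
      using derr by (intro DERIV_continuous_on) auto
    then obtain a b where ab: "s \<le> a" "a < b" "b \<le> q" "G r a = l * K" "G r b = l * K + \<eta>"
      "\<And>x. x \<in> {a..b} \<Longrightarrow> G r x \<in> {l * K..l * K + \<eta>}"
      using exists_crossing_interval[of s q "G r" "l * K" "l * K + \<eta>"] l drift s \<open>\<eta> > 0\<close> by auto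
    \<comment> \<open>At level 0 this removes \<open>l * M * x ^ r\<close>; at level
      \<open>Suc r\<close> it changes nothing, so the bound \<open>\<theta>\<close>
      survives.\<close>
    define G' where "G' i x = G i x - monomial_tower (l * K) r i x" for i x
    have "\<exists>a' b' (c :: nat \<Rightarrow> int). a \<le> a' \<and> a' + L \<le> b' \<and> b' \<le> b \<and>
        (\<forall>x\<in>{a'..b'}. G' 0 x - of_int M * (\<Sum>i<r. of_int (c i) * x ^ i) \<in> {0..1/2})"
    proof (rule IH[unfolded forces_poly_approx_def, rule_format])
      fix i x assume i: "i \<le> r" and x: "x \<in> {a..b}"
      have "(G i has_real_derivative G (Suc i) x) (at x within {a..b})"
        by (rule DERIV_subset[OF der[rule_format, of i x]]) (use i x ab s in auto)
      then show "(G' i has_real_derivative G' (Suc i) x) (at x within {a..b})"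
        unfolding G'_def[abs_def] by (intro DERIV_diff has_derivative_monomial_tower)
    next
      fix x assume "x \<in> {a..b}"
      then show "G' r x \<in> {0..\<eta>} \<and> \<bar>G' (Suc r) x\<bar> \<le> \<theta>"
        using ab(1,3) ab(6)[of x] G(3)[rule_format, of x] s by (auto simp: G'_def)
    qed (use ab in \<open>auto simp: G'_def\<close>)
    then obtain a' b' and c :: "nat \<Rightarrow> int" where c: "a \<le> a'" "a' + L \<le> b'" "b' \<le> b"
       "\<And>x. x \<in> {a'..b'} \<Longrightarrow> G' 0 x - of_int M * (\<Sum>i<r. of_int (c i) * x ^ i) \<in> {0..1/2}"
      by blast
    have "G' 0 x - of_int M * (\<Sum>i<r. of_int (c i) * x ^ i)
      = G 0 x - of_int M * (\<Sum>i<Suc r. of_int ((c(r := l)) i) * x ^ i)" for x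
      by (simp add: G'_def monomial_tower_def K_def algebra_simps)
    with c have "\<forall>x\<in>{a'..b'}. G 0 x - of_int M * (\<Sum>i<Suc r. of_int ((c(r := l)) i) * x ^ i) \<in> {0..1/2}"
      by metis
    with c ab s show "\<exists>a b (c :: nat \<Rightarrow> int). p \<le> a \<and> a + L \<le> b \<and> b \<le> q \<and>
        (\<forall>x\<in>{a..b}. G 0 x - of_int M * (\<Sum>i<Suc r. of_int (c i) * x ^ i) \<in> {0..1/2})"
      by (intro exI[of _ a'] exI[of _ b'] exI[of _ "c(r := l)"]) auto
  qed (use \<open>\<theta> > 0\<close> \<open>\<theta>' > 0\<close> in auto)
qed

section \<open>Roots of integer polynomials modulo a prime\<close>

text \<open>Lagrange's root bound modulo \<open>p\<close>: splitting off the factor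
  \<open>x - a\<close> for a root \<open>a\<close> keeps the top coefficient and leaves the other
  points as roots of the quotient.\<close>

lemma prime_dvd_coeff_if_many_roots:
  fixes p :: int and Q :: "int poly"
  assumes "prime p" "finite S" "card S = Suc d" "degree Q \<le> d"
    and "\<And>x y. x \<in> S \<Longrightarrow> y \<in> S \<Longrightarrow> p dvd x - y \<Longrightarrow> x = y"
    and "\<And>x. x \<in> S \<Longrightarrow> p dvd poly Q x"
  shows "p dvd coeff Q d"
  using assms(2-)
proof (induction d arbitrary: S Q)
  case 0
  obtain a where "a \<in> S" using "0.prems"(2) by (metis card_eq_SucD insertI1)
  moreover obtain c where "Q = [:c:]" using "0.prems"(3) by (auto elim: degree_eq_zeroE)
  ultimately show ?case using "0.prems"(5)[of a] by simp
next
  case (Suc d)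
  obtain a where a: "a \<in> S" using Suc.prems(2) by (metis card_eq_SucD insertI1)
  define R where "R = synthetic_div Q a"
  have Q: "[:-a, 1:] * R + [:poly Q a:] = Q" unfolding R_def by (rule synthetic_div_correct')
  have "degree R \<le> d" using Suc.prems by (simp add: R_def degree_synthetic_div)
  have "p dvd coeff R d"
  proof (rule Suc.IH[of "S - {a}"])
    fix x assume x: "x \<in> S - {a}"
    have "poly Q x = (x - a) * poly R x + poly Q a"
      by (subst Q[symmetric]) (simp add: algebra_simps)
    then have "p dvd (x - a) * poly R x"
      using Suc.prems(5)[of x] Suc.prems(5)[of a] a x by (metis DiffD1 dvd_add_left_iff)
    moreover have "\<not> p dvd x - a" using x a Suc.prems(4) by blast
    ultimately show "p dvd poly R x" using \<open>prime p\<close> prime_dvd_mult_iff by blast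
  qed (use Suc.prems a \<open>degree R \<le> d\<close> in auto)
  moreover have "coeff Q (Suc d) = coeff R d"
    by (subst Q[symmetric]) (use \<open>degree R \<le> d\<close> in \<open>simp add: coeff_eq_0\<close>)
  ultimately show ?case by simp
qed


section \<open>Windows on which the floor values are polynomial\<close>

text \<open>A slow upward crossing of the level \<open>fact r * M ^ j\<close> by \<open>F r\<close>
  becomes, once \<open>M ^ j * x ^ r + 1\<close> is subtracted, the climb treated by
  \<open>forces_poly_approx\<close>.\<close>

lemma exists_poly_window:
  fixes F :: "nat \<Rightarrow> real \<Rightarrow> real" and M :: int and H :: nat
  assumes "r \<ge> 1"
    and der: "\<And>i x. i \<le> r \<Longrightarrow> x \<ge> 1 \<Longrightarrow> (F i has_real_derivative F (Suc i) x) (at x within {1..})"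
    and lim: "(F (Suc r) \<longlongrightarrow> 0) at_top" and unb: "\<And>B X. \<exists>x\<ge>X. F r x \<ge> B"
    and "M > 1"
  obtains n0 :: nat and Q :: "int poly" and j :: nat
  where "n0 \<ge> 1" "degree Q \<le> r" "coeff Q r = M ^ j" "\<And>x. M dvd poly Q x - 1"
    "\<And>n. n \<in> {n0..<n0 + H} \<Longrightarrow> \<lfloor>F 0 (real n)\<rfloor> = poly Q (int n)"
proof -
  \<comment> \<open>Length \<open>H + 1\<close> is positive even for \<open>H = 0\<close> and leaves
    room for \<open>H\<close> consecutive integers after rounding the left end up.\<close>
  obtain \<eta> \<theta> where "\<eta> > 0" "\<theta> > 0" and approx: "forces_poly_approx M (real H + 1) r \<eta> \<theta>"
    using forces_poly_approx_exists[of M "real H + 1" r] \<open>M > 1\<close> by auto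
  have "eventually (\<lambda>x. \<bar>F (Suc r) x\<bar> < \<theta>) at_top"
    using tendstoD[OF lim \<open>\<theta> > 0\<close>] by (simp add: dist_norm)
  then obtain X0 where X0: "\<And>x. x \<ge> X0 \<Longrightarrow> \<bar>F (Suc r) x\<bar> < \<theta>"
    by (auto simp: eventually_at_top_linorder)
  define X where "X = max 1 X0"
  obtain j0 where j0: "F r X < of_int M ^ j0"
    using real_arch_pow[of "of_int M" "F r X"] \<open>M > 1\<close> by auto
  \<comment> \<open>The extra factor \<open>M\<close> makes the leading coefficient divisible by
    \<open>M\<close>, as \<open>Q = 1\<close> modulo \<open>M\<close> requires.\<close>
  define j where "j = Suc j0"
  define C :: real where "C = fact r * of_int M ^ j"
  have "real_of_int M ^ j0 * 1 \<le> real_of_int M ^ j0 * (fact r * of_int M)"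
    using \<open>M > 1\<close> by (intro mult_left_mono) (auto intro: mult_ge1_I)
  then have FX: "F r X \<le> C"
    using j0 by (simp add: C_def j_def mult_ac)
  obtain q where q: "q \<ge> X" "F r q \<ge> C + \<eta>" using unb by blast
  have "continuous_on {X..q} (F r)"
    by (rule DERIV_continuous_on, rule DERIV_subset[OF der]) (auto simp: X_def)
  then obtain a b where ab: "X \<le> a" "a < b" "b \<le> q" "F r a = C" "F r b = C + \<eta>"
      "\<And>x. x \<in> {a..b} \<Longrightarrow> F r x \<in> {C..C + \<eta>}"
    using exists_crossing_interval[of X q "F r" C "C + \<eta>"] q FX \<open>\<eta> > 0\<close> by auto
  \<comment> \<open>The last term is the constant 1; since \<open>r\<close> is at least 1, it does
    not affect levels \<open>r\<close> and \<open>Suc r\<close>.\<close>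
  define G where "G i x = F i x - monomial_tower C r i x - monomial_tower 1 0 i x" for i x
  have "\<exists>a' b' (c :: nat \<Rightarrow> int). a \<le> a' \<and> a' + (real H + 1) \<le> b' \<and> b' \<le> b \<and>
      (\<forall>x\<in>{a'..b'}. G 0 x - of_int M * (\<Sum>i<r. of_int (c i) * x ^ i) \<in> {0..1/2})"
  proof (rule approx[unfolded forces_poly_approx_def, rule_format])
    fix i x assume i: "i \<le> r" and x: "x \<in> {a..b}"
    have "(F i has_real_derivative F (Suc i) x) (at x within {a..b})"
      by (rule DERIV_subset[OF der]) (use i x ab in \<open>auto simp: X_def\<close>)
    then show "(G i has_real_derivative G (Suc i) x) (at x within {a..b})"
      unfolding G_def[abs_def] by (intro DERIV_diff has_derivative_monomial_tower)
  next
    fix x assume x: "x \<in> {a..b}"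
    then have "\<bar>F (Suc r) x\<bar> < \<theta>"
      using X0[of x] ab by (auto simp: X_def)
    then show "G r x \<in> {0..\<eta>} \<and> \<bar>G (Suc r) x\<bar> \<le> \<theta>"
      using ab(6)[OF x] \<open>r \<ge> 1\<close> by (simp add: G_def)
  qed (use ab \<open>r \<ge> 1\<close> in \<open>auto simp: G_def\<close>)
  then obtain a' b' and c :: "nat \<Rightarrow> int" where c: "a \<le> a'" "a' + (real H + 1) \<le> b'" "b' \<le> b"
      "\<And>x. x \<in> {a'..b'} \<Longrightarrow> G 0 x - of_int M * (\<Sum>i<r. of_int (c i) * x ^ i) \<in> {0..1/2}"
    by blast
  define Q where "Q = 1 + monom (M ^ j) r + smult M (\<Sum>i<r. monom (c i) i)"
  have poly_Q: "poly Q x = 1 + M * (M ^ j0 * x ^ r + (\<Sum>i<r. c i * x ^ i))" for x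
    by (simp add: Q_def poly_sum poly_monom j_def algebra_simps)
  show thesis
  proof (rule that[of "nat \<lceil>a'\<rceil>" Q j])
    have "a' \<ge> 1" using c ab by (auto simp: X_def)
    then show "nat \<lceil>a'\<rceil> \<ge> 1" by linarith
    show "degree Q \<le> r"
      by (rule degree_le) (auto simp: Q_def coeff_sum)
    show "coeff Q r = M ^ j"
      using \<open>r \<ge> 1\<close> by (auto simp: Q_def coeff_sum)
    show "M dvd poly Q x - 1" for x
      unfolding poly_Q by simp
    fix n assume n: "n \<in> {nat \<lceil>a'\<rceil>..<nat \<lceil>a'\<rceil> + H}"
    then have "real n \<in> {a'..b'}"
      using c \<open>a' \<ge> 1\<close> by auto linarith+
    from c(4)[OF this] have "F 0 n - of_int (poly Q (int n)) \<in> {0..1/2}"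
      by (simp add: G_def monomial_tower_def C_def poly_Q j_def algebra_simps)
    then show "\<lfloor>F 0 (real n)\<rfloor> = poly Q (int n)"
      by (intro floor_unique) auto
  qed
qed

text \<open>Coprimality to \<open>M\<close> serves to separate this window from earlier ones; the
  gcd clause handles points inside one window.\<close>

lemma exists_coprime_window:
  fixes F :: "nat \<Rightarrow> real \<Rightarrow> real" and M :: int and H :: nat
  assumes "r \<ge> 1"
    and der: "\<And>i x. i \<le> r \<Longrightarrow> x \<ge> 1 \<Longrightarrow> (F i has_real_derivative F (Suc i) x) (at x within {1..})"
    and lim: "(F (Suc r) \<longlongrightarrow> 0) at_top" and unb: "\<And>B X. \<exists>x\<ge>X. F r x \<ge> B"
    and "M \<noteq> 0"
  shows "\<exists>n0\<ge>1. (\<forall>n\<in>{n0..<n0 + H}. \<lfloor>F 0 (real n)\<rfloor> \<noteq> 0 \<and> coprime \<lfloor>F 0 (real n)\<rfloor> M) \<and>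
    (\<forall>N. N \<subseteq> {n0..<n0 + H} \<and> card N = Suc r \<longrightarrow> Gcd ((\<lambda>n. \<lfloor>F 0 (real n)\<rfloor>) ` N) = 1)"
proof -
  \<comment> \<open>The factor 2 gives \<open>M' > 1\<close> and so excludes the value 0,
    \<open>M\<close> passes on coprimality, and \<open>fact H\<close> keeps window points distinct
    modulo \<open>p\<close>.\<close>
  define M' where "M' = 2 * \<bar>M\<bar> * fact H"
  have "M' \<ge> 2 * 1 * 1"
    unfolding M'_def using \<open>M \<noteq> 0\<close> by (intro mult_mono) (auto simp: fact_ge_1)
  then obtain n0 Q j where Q: "n0 \<ge> 1" "degree Q \<le> r" "coeff Q r = M' ^ j" 
    "\<And>x. M' dvd poly Q x - 1" "\<And>n. n \<in> {n0..<n0 + H} \<Longrightarrow> \<lfloor>F 0 (real n)\<rfloor> = poly Q (int n)"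
    using exists_poly_window[of r F M' H] assms by auto
  have coprime: "coprime (poly Q x) M'" for x
    using Q(4)[of x] by (intro coprimeI) (metis dvd_diffD dvd_trans dvd_diff_right_iff)
  have "poly Q x \<noteq> 0" for x
    using coprime[of x] \<open>M' \<ge> 2 * 1 * 1\<close> by auto
  moreover have "coprime (poly Q x) M" for x
    by (rule coprime_divisors[OF dvd_refl _ coprime[of x]]) (simp add: M'_def)
  moreover have "Gcd ((\<lambda>n. \<lfloor>F 0 (real n)\<rfloor>) ` N) = 1" if N: "N \<subseteq> {n0..<n0 + H}" "card N = Suc r" for N
  proof (rule ccontr)
    assume not1: "Gcd ((\<lambda>n. \<lfloor>F 0 (real n)\<rfloor>) ` N) \<noteq> 1"
    have "\<exists>p :: int. prime p \<and> p dvd Gcd ((\<lambda>n. \<lfloor>F 0 (real n)\<rfloor>) ` N)"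
    \<comment> \<open>A gcd equal to 0 is divisible by every prime, so 2 serves.\<close>
    proof (cases "Gcd ((\<lambda>n. \<lfloor>F 0 (real n)\<rfloor>) ` N) = 0")
      case True
      show ?thesis unfolding True by (intro exI[of _ 2]) auto
    next
      case False
      moreover have "\<not> is_unit (Gcd ((\<lambda>n. \<lfloor>F 0 (real n)\<rfloor>) ` N))" using not1 by simp
      ultimately show ?thesis using prime_divisor_exists by metis
    qed
    then obtain p :: int where p: "prime p" "p dvd Gcd ((\<lambda>n. \<lfloor>F 0 (real n)\<rfloor>) ` N)" by blast
    have p_dvd: "p dvd poly Q (int n)" if "n \<in> N" for n
      using p(2) that Q(5)[of n] N(1) by (metis Gcd_dvd dvd_trans imageI subsetD)
    obtain m where "m \<in> N" using N(2) by (metis card_eq_SucD insertI1)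
    then have not_dvd: "\<not> p dvd M'"
      using coprime p_dvd p(1) by (metis coprime_common_divisor not_prime_unit)
    have "p dvd coeff Q r"
    proof (rule prime_dvd_coeff_if_many_roots[of p "int ` N"])
      show "finite (int ` N)" using N(1) finite_subset by blast
      show "card (int ` N) = Suc r" using N(2) by (simp add: card_image)
      fix x y assume xy: "x \<in> int ` N" "y \<in> int ` N" "p dvd x - y"
      show "x = y"
      proof (rule ccontr)
        assume "x \<noteq> y"
        moreover have "x \<in> {int n0..<int n0 + int H}" "y \<in> {int n0..<int n0 + int H}"
          using xy(1,2) N(1) by auto
        ultimately have "\<bar>x - y\<bar> > 0" "\<bar>x - y\<bar> < int H" by auto
        then have "nat \<bar>x - y\<bar> dvd fact H" by (intro dvd_fact) auto
        then have "int (nat \<bar>x - y\<bar>) dvd int (fact H)" by (simp only: int_dvd_int_iff)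
        then have "x - y dvd fact H" by simp
        then have "p dvd fact H" using xy(3) dvd_trans by blast
        then show False using not_dvd by (simp add: M'_def)
      qed
    qed (use p Q p_dvd in auto)
    then show False using not_dvd p(1) Q(3) prime_dvd_power by metis
  qed
  ultimately show ?thesis using Q(1,5) by (intro exI[of _ n0]) auto
qed


section \<open>Gluing the windows together\<close>

text \<open>Window \<open>j\<close> has length \<open>j\<close> and values coprime to all earlier
  ones. So \<open>k\<close> points either meet two windows, where two values are already coprime, or
  lie in a single one.\<close>

lemma exists_coprime_windows:
  fixes g :: "nat \<Rightarrow> int"
  assumes "k \<ge> 2" and window: "\<And>(M :: int) H. M \<noteq> 0 \<Longrightarrow> \<exists>a\<ge>1. (\<forall>n\<in>{a..<a + H}. g n \<noteq> 0 \<and> coprime (g n) M) \<and>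
    (\<forall>N. N \<subseteq> {a..<a + H} \<and> card N = k \<longrightarrow> Gcd (g ` N) = 1)"
  shows "\<exists>A. A \<subseteq> {1..} \<and> (\<forall>H. \<exists>a. {a..<a + H} \<subseteq> A) \<and> (\<forall>N. N \<subseteq> A \<and> card N = k \<longrightarrow> Gcd (g ` N) = 1)"
proof -
  obtain w where w: "\<And>M H. M \<noteq> 0 \<Longrightarrow> w M H \<ge> 1"
      "\<And>M H n. M \<noteq> 0 \<Longrightarrow> n \<in> {w M H..<w M H + H} \<Longrightarrow> g n \<noteq> 0 \<and> coprime (g n) M"
      "\<And>M H N. M \<noteq> 0 \<Longrightarrow> N \<subseteq> {w M H..<w M H + H} \<Longrightarrow> card N = k \<Longrightarrow> Gcd (g ` N) = 1"
    using window by metis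
  \<comment> \<open>\<open>m j\<close> is the product of the values on the windows before
    \<open>j\<close>; it stays nonzero because the values do, which lets the recursion
    continue.\<close>
  define m where "m = rec_nat 1 (\<lambda>j M. M * (\<Prod>n\<in>{w M j..<w M j + j}. g n))"
  define W where "W j = {w (m j) j..<w (m j) j + j}" for j
  have m_Suc: "m (Suc j) = m j * (\<Prod>n\<in>W j. g n)" for j
    by (simp add: m_def W_def)
  have m_nz: "m j \<noteq> 0" for j
  proof (induction j)
    case (Suc j)
    then show ?case unfolding m_Suc using w(2)[OF Suc, of _ j] by (auto simp: W_def)
  qed (simp add: m_def)
  have g_dvd: "g n dvd m j" if "i < j" "n \<in> W i" for i j n
    using that
  proof (induction j)
    case (Suc j)
    have "g n dvd (\<Prod>n\<in>W j. g n)" if "i = j"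
      using Suc.prems that by (intro dvd_prodI) (auto simp: W_def)
    with Suc show ?case unfolding m_Suc by (cases "i = j") auto
  qed simp
  have cross: "coprime (g n) (g n')" if "i < j" "n \<in> W i" "n' \<in> W j" for i j n n'
    using coprime_divisors[OF g_dvd[OF that(1,2)] dvd_refl, of "g n'"] w(2)[OF m_nz, of n' j j] that(3)
    by (auto simp: W_def coprime_commute)
  have "Gcd (g ` N) = 1" if N: "N \<subseteq> (\<Union>j. W j)" "card N = k" for N
  proof -
    obtain idx where idx: "\<And>n. n \<in> N \<Longrightarrow> n \<in> W (idx n)" using N(1) by (metis UN_E subsetD)
    show ?thesis
    proof (cases "\<exists>n\<in>N. \<exists>n'\<in>N. idx n < idx n'")
      case True
      then obtain n n' where "n \<in> N" "n' \<in> N" "coprime (g n) (g n')" using idx cross by metis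
      then have "is_unit (Gcd (g ` N))" by (metis Gcd_dvd coprime_common_divisor imageI)
      then show ?thesis by simp
    next
      case False
      obtain n0 where "n0 \<in> N" using N(2) \<open>k \<ge> 2\<close> by fastforce
      with False idx have "N \<subseteq> W (idx n0)" by (metis linorder_neqE_nat subsetI)
      then show ?thesis using w(3)[OF m_nz] N(2) by (simp add: W_def)
    qed
  qed
  \<comment> \<open>The window \<open>W H\<close> itself has length \<open>H\<close>.\<close>
  moreover have "\<exists>a. {a..<a + H} \<subseteq> (\<Union>j. W j)" for H
    unfolding W_def by blast
  moreover have "(\<Union>j. W j) \<subseteq> {1..}"
    unfolding W_def using w(1)[OF m_nz] by (meson UN_least atLeast_iff atLeastLessThan_iff order_trans subsetI)
  ultimately show ?thesis by blast
qed

section \<open>Upper Banach density from long runs of integers\<close>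

text \<open>For each \<open>H > 0\<close> the limsup lies between \<open>1 - 1 / H\<close> and
  \<open>1 + 1 / H\<close>: an interval of length \<open>H\<close> holds at most
  \<open>H + 1\<close> integers, and arbitrarily far out some such interval has at least
  \<open>H - 1\<close> of them in \<open>A\<close>.\<close>

lemma has_upper_Banach_density_1:
  assumes "\<And>L. \<exists>a. {a..<a + L} \<subseteq> A"
  shows "has_upper_Banach_density A 1"
  unfolding has_upper_Banach_density_def
proof (rule tendsto_sandwich)
  let ?c = "\<lambda>H x. real (card {n \<in> A. real n \<in> {x<..x + H}})"
  show "\<forall>\<^sub>F H :: real in at_top. Limsup at_top (\<lambda>x. ereal (1 / H * ?c H x)) \<le> ereal (1 + 1 / H)"
    using eventually_gt_at_top[of 0]
  proof eventually_elim
    case (elim H)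
    have "ereal (1 / H * ?c H x) \<le> ereal (1 + 1 / H)" if "x \<ge> 0" for x
    proof -
      have "card {n \<in> A. real n \<in> {x<..x + H}} \<le> card {nat \<lfloor>x\<rfloor><..nat \<lfloor>x + H\<rfloor>}"
        using that elim by (intro card_mono) (auto, linarith+)
      also have "real \<dots> \<le> H + 1"
        using that elim by simp linarith
      finally show ?thesis using elim by (simp add: field_simps)
    qed
    then show ?case
      by (intro Limsup_bounded eventually_mono[OF eventually_ge_at_top[of 0]])
  qed
  show "\<forall>\<^sub>F H :: real in at_top. ereal (1 - 1 / H) \<le> Limsup at_top (\<lambda>x. ereal (1 / H * ?c H x))"
    using eventually_gt_at_top[of 0]
  proof eventually_elim
    case (elim H)
    have "\<exists>x\<ge>X. ereal (1 - 1 / H) \<le> ereal (1 / H * ?c H x)" for X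
    proof -
      define h where "h = nat \<lfloor>H\<rfloor>"
      \<comment> \<open>The run is longer than needed: skipping \<open>nat \<lceil>X\<rceil>\<close>
        entries pushes its start beyond \<open>X\<close>, and the extra 1 pays for \<open>y\<close>,
        which the half-open interval omits.\<close>
      obtain a where a: "{a..<a + (nat \<lceil>X\<rceil> + h + 1)} \<subseteq> A" using assms by blast
      define y where "y = a + nat \<lceil>X\<rceil>"
      have "real y \<ge> X" unfolding y_def by linarith
      have "{y<..y + h} \<subseteq> {n \<in> A. real n \<in> {real y<..real y + H}}"
        using a elim by (auto simp: y_def h_def) linarith
      moreover have "finite {n \<in> A. real n \<in> {real y<..real y + H}}"
        by (rule finite_subset[of _ "{..nat \<lfloor>real y + H\<rfloor>}"]) (auto, linarith)
      ultimately have "card {y<..y + h} \<le> card {n \<in> A. real n \<in> {real y<..real y + H}}"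
        by (rule card_mono[rotated])
      then have "real h \<le> ?c H (real y)" by simp
      moreover have "H - 1 \<le> real h" using elim unfolding h_def by linarith
      ultimately have "(H - 1) / H \<le> ?c H (real y) / H"
        using elim by (intro divide_right_mono) auto
      then have "1 - 1 / H \<le> 1 / H * ?c H (real y)" using elim by (simp add: diff_divide_distrib)
      then show ?thesis using \<open>real y \<ge> X\<close> by auto
    qed
    then have "\<not> (\<forall>\<^sub>F x in at_top. ereal (1 / H * ?c H x) < ereal (1 - 1 / H))"
      unfolding eventually_at_top_linorder by (meson not_less)
    then show ?case
      using Limsup_lessD not_less by blast
  qed
  have "((\<lambda>H :: real. 1 / H) \<longlongrightarrow> 0) at_top"
    by (intro tendsto_divide_0[OF tendsto_const] filterlim_at_top_imp_at_infinity filterlim_ident)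
  from tendsto_add[OF tendsto_const[of 1] this] tendsto_diff[OF tendsto_const[of 1] this]
  show "((\<lambda>H. ereal (1 + 1 / H)) \<longlongrightarrow> 1) at_top" "((\<lambda>H. ereal (1 - 1 / H)) \<longlongrightarrow> 1) at_top"
    unfolding one_ereal_def lim_ereal by simp_all
qed

theorem theorem5:
  fixes k :: nat and f :: "real \<Rightarrow> real"
  assumes "k \<ge> 2"
    and "C_on k {1..} f"
    and "(deriv_within {1..} k f \<longlongrightarrow> 0) at_top"
    and "Limsup at_top (\<lambda>x. ereal (deriv_within {1..} (k - 1) f x)) = \<infinity>"
  shows "\<exists>A :: nat set. A \<subseteq> {1..} \<and> infinite A \<and> has_upper_Banach_density A 1 \<and>
           (\<forall>N. N \<subseteq> A \<and> card N = k \<longrightarrow> Gcd ((\<lambda>n. \<lfloor>f (real n)\<rfloor>) ` N) = 1)"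
proof -
  define F where "F i = deriv_within {1..} i f" for i
  \<comment> \<open>The window lemmas are used with \<open>r = k - 1\<close>, so
    \<open>Suc r\<close> is both the order of the vanishing derivative and the number of
    points.\<close>
  have k: "Suc (k - 1) = k" "k - 1 \<ge> 1" using \<open>k \<ge> 2\<close> by auto
  have der: "(F i has_real_derivative F (Suc i) x) (at x within {1..})" if "i \<le> k - 1" "x \<ge> 1" for i x
  proof -
    have "F i differentiable (at x within {1..})"
      using \<open>C_on k {1..} f\<close> that k by (auto simp: C_on_def F_def differentiable_on_def)
    then show ?thesis
      by (simp add: F_def vector_derivative_works has_real_derivative_iff_has_vector_derivative)
  qed
  \<comment> \<open>Were \<open>F (k - 1)\<close> below \<open>B\<close> from \<open>X\<close> on,
    its limsup would be at most \<open>B\<close>.\<close>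
  have unb: "\<exists>x\<ge>X. F (k - 1) x \<ge> B" for B X
  proof (rule ccontr)
    assume "\<not> (\<exists>x\<ge>X. F (k - 1) x \<ge> B)"
    then have "Limsup at_top (\<lambda>x. ereal (F (k - 1) x)) \<le> ereal B"
      by (intro Limsup_bounded eventually_mono[OF eventually_ge_at_top[of X]]) force
    then show False using assms(4) by (simp add: F_def)
  qed
  have lim: "(F (Suc (k - 1)) \<longlongrightarrow> 0) at_top" using assms(3) k by (simp add: F_def)
  obtain A where A: "A \<subseteq> {1..}" "\<And>H. \<exists>a. {a..<a + H} \<subseteq> A"
      "\<And>N. N \<subseteq> A \<and> card N = k \<longrightarrow> Gcd ((\<lambda>n. \<lfloor>f (real n)\<rfloor>) ` N) = 1"
    using exists_coprime_windows[OF \<open>k \<ge> 2\<close>, of "\<lambda>n. \<lfloor>f (real n)\<rfloor>"]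
      exists_coprime_window[OF k(2) der lim unb] k(1) by (auto simp: F_def)
  have "infinite A"
  proof
    assume "finite A"
    obtain a where "{a..<a + Suc (card A)} \<subseteq> A" using A(2) by blast
    from card_mono[OF \<open>finite A\<close> this] show False by simp
  qed
  with A has_upper_Banach_density_1[of A] show ?thesis by blast
qed

end
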